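(* For every $s\ge1$ and every positive integer $l$, the vector $\tilde I^{[lp^s-1]}_{p^s}(z)\in\mathbb Z[z]^n$ is a solution of the KZ system modulo $p^s$. Moreover, for every $t=1,\dots,s$ one has $\tilde{\mathcal M}^t_{p^s}=\mathcal M^t_{p^s}$.
   Context: Let $p$ be an odd prime, $g\ge1$, $n=2g+1$, with $p>n$. Write $z=(z_1,\dots,z_n)$. For $1\le i\ne j\le n$ let $\Omega_{ij}$ be the $n\times n$ matrix whose $(i,i)$ and $(j,j)$ entries are $-1$, whose $(i,j)$ and $(j,i)$ entries are $1$, and all of whose other entries are $0$. The KZ system is the system for a column vector $I=(I_1,\dots,I_n)$ of functions of $z$: $\frac{\partial I}{\partial z_i}=\frac12\sum_{j\ne i}\frac{\Omega_{ij}}{z_i-z_j}\,I$ for $i=1,\dots,n$, together with $I_1+\dots+I_n=0$. $\pi_s$ denotes reduction modulo $p^s$. A vector $I(z)\in\mathbb Z[z]^n$ is a solution of the KZ system modulo $p^s$ if $\pi_sI\in(\mathbb Z/p^s\mathbb Z)[z]^n$ satisfies the KZ system (the differential equations being understood in $(\mathbb Z/p^s\mathbb Z)[z]$ after multiplying the $i$-th equation by $\prod_{j\ne i}(z_i-z_j)$). Quasi-constants: $f\in\mathbb Z[z]$ is a quasi-constant modulo $p^r$ if $\partial f/\partial z_i\in p^r\mathbb Z[z]$ for all $i$; these form a ring $\mathbb Z[z]_{p^r}$. For a positive integer $r$ put $M_r=(p^r-1)/2$, $\Phi_{p^r}(x,z)=\prod_{i=1}^n(x-z_i)^{M_r}$,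 expand $\Big(\frac{\Phi_{p^r}}{x-z_1},\dots,\frac{\Phi_{p^r}}{x-z_n}\Big)=\sum_iP^i_{p^r}(z)x^i$ with $P^i_{p^r}(z)\in\mathbb Z[z]^n$, and set $I^{[lp^r-1]}_{p^r}(z)=P^{lp^r-1}_{p^r}(z)$. Also substitute $x=v+z_n$ and expand $\Big(\frac{\Phi_{p^r}(v+z_n,z)}{v+z_n-z_1},\dots,\frac{\Phi_{p^r}(v+z_n,z)}{v}\Big)=\sum_i\tilde P^i_{p^r}(z)v^i$ with $\tilde P^i_{p^r}(z)\in\mathbb Z[z]^n$, and set $\tilde I^{[lp^r-1]}_{p^r}(z)=\tilde P^{lp^r-1}_{p^r}(z)$. For $1\le t\le s$ define $\mathcal M^t_{p^s}=\{\pi_s(\sum_{r=1}^t\sum_{l=1}^g c_{r,l}(z)\,p^{s-r}I^{[lp^r-1]}_{p^r}(z)) : c_{r,l}\in\mathbb Z[z]_{p^r}\}$ and $\tilde{\mathcal M}^t_{p^s}=\{\pi_s(\sum_{r=1}^t\sum_{l=1}^g c_{r,l}(z)\,p^{s-r}\tilde I^{[lp^r-1]}_{p^r}(z)) : c_{r,l}\in\mathbb Z[z]_{p^r}\}$. *)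

theory Defs
  imports "HOL-Library.Poly_Mapping" "HOL-Computational_Algebra.Polynomial"
begin

text \<open>Integer multivariate polynomials: finitely supported maps from monomials
  (exponent vectors, variable index \<Rightarrow> exponent) to integer coefficients.
  The ring Z[z] = Z[z_1,...,z_n] consists of those involving only variables 1..n.\<close>

type_synonym mpoly = "(nat \<Rightarrow>\<^sub>0 nat) \<Rightarrow>\<^sub>0 int"

definition Var :: "nat \<Rightarrow> mpoly" where
  "Var i = Poly_Mapping.single (Poly_Mapping.single i 1) 1"

definition in_Zz :: "nat \<Rightarrow> mpoly \<Rightarrow> bool" where
  "in_Zz n f \<longleftrightarrow> (\<forall>m\<in>Poly_Mapping.keys f. Poly_Mapping.keys (m::nat \<Rightarrow>\<^sub>0 nat) \<subseteq> {1..n})"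

definition pdiff :: "nat \<Rightarrow> mpoly \<Rightarrow> mpoly" where
  "pdiff i f = (\<Sum>m::nat \<Rightarrow>\<^sub>0 nat \<in> Poly_Mapping.keys f.
      Poly_Mapping.single (m - Poly_Mapping.single i 1) (int (Poly_Mapping.lookup m i) * Poly_Mapping.lookup f m))"

definition cong_mp :: "int \<Rightarrow> mpoly \<Rightarrow> mpoly \<Rightarrow> bool" where
  "cong_mp q f g \<longleftrightarrow> (\<forall>m. Poly_Mapping.lookup f m mod q = Poly_Mapping.lookup g m mod q)"

definition red :: "int \<Rightarrow> mpoly \<Rightarrow> mpoly" where
  "red q f = Poly_Mapping.map (\<lambda>c. c mod q) f"

definition Omega :: "nat \<Rightarrow> nat \<Rightarrow> nat \<Rightarrow> nat \<Rightarrow> int" where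
  "Omega i j a b =
     (if (a = i \<and> b = i) \<or> (a = j \<and> b = j) then -1
      else if (a = i \<and> b = j) \<or> (a = j \<and> b = i) then 1 else 0)"

text \<open>Vectors I = (I_1,...,I_n) are represented as functions on indices 1..n.
  KZ system modulo q: the i-th equation dI/dz_i = 1/2 sum_{j<>i} Omega_ij I/(z_i-z_j),
  multiplied by prod_{j<>i}(z_i-z_j) (and by the unit 2), holds in (Z/q)[z],
  together with I_1 + ... + I_n = 0 in (Z/q)[z].\<close>
definition KZ_sol_mod :: "int \<Rightarrow> nat \<Rightarrow> (nat \<Rightarrow> mpoly) \<Rightarrow> bool" where
  "KZ_sol_mod q n I \<longleftrightarrow>
     (\<forall>i\<in>{1..n}. \<forall>a\<in>{1..n}.
        cong_mp q
          (2 * (\<Prod>j\<in>{1..n}-{i}. Var i - Var j) * pdiff i (I a))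
          (\<Sum>j\<in>{1..n}-{i}. (\<Prod>k\<in>{1..n}-{i,j}. Var i - Var k) *
              (\<Sum>b\<in>{1..n}. of_int (Omega i j a b) * I b)))
     \<and> cong_mp q (\<Sum>a\<in>{1..n}. I a) 0"

definition quasi_const :: "nat \<Rightarrow> nat \<Rightarrow> nat \<Rightarrow> mpoly \<Rightarrow> bool" where
  "quasi_const n p r f \<longleftrightarrow> in_Zz n f \<and>
     (\<forall>i\<in>{1..n}. \<forall>m. (int p ^ r) dvd Poly_Mapping.lookup (pdiff i f) m)"

definition Mr :: "nat \<Rightarrow> nat \<Rightarrow> nat" where
  "Mr p r = (p ^ r - 1) div 2"

text \<open>k-th component of (Phi_{p^r}/(x-z_1), ..., Phi_{p^r}/(x-z_n)) as a polynomial in x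
  over Z[z]; Phi_{p^r}(x,z) = prod_i (x - z_i)^{M_r}.\<close>
definition PhiComp :: "nat \<Rightarrow> nat \<Rightarrow> nat \<Rightarrow> nat \<Rightarrow> mpoly poly" where
  "PhiComp p n r k = [:- Var k, 1:] ^ (Mr p r - 1) *
     (\<Prod>i\<in>{1..n}-{k}. [:- Var i, 1:] ^ Mr p r)"

definition PhiCompT :: "nat \<Rightarrow> nat \<Rightarrow> nat \<Rightarrow> nat \<Rightarrow> mpoly poly" where
  "PhiCompT p n r k = pcompose (PhiComp p n r k) [:Var n, 1:]"

definition Ivec :: "nat \<Rightarrow> nat \<Rightarrow> nat \<Rightarrow> nat \<Rightarrow> nat \<Rightarrow> mpoly" where
  "Ivec p n r l k = coeff (PhiComp p n r k) (l * p ^ r - 1)"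

definition IvecT :: "nat \<Rightarrow> nat \<Rightarrow> nat \<Rightarrow> nat \<Rightarrow> nat \<Rightarrow> mpoly" where
  "IvecT p n r l k = coeff (PhiCompT p n r k) (l * p ^ r - 1)"

definition Mspace :: "nat \<Rightarrow> nat \<Rightarrow> nat \<Rightarrow> nat \<Rightarrow> nat
    \<Rightarrow> (nat \<Rightarrow> nat \<Rightarrow> nat \<Rightarrow> mpoly) \<Rightarrow> (nat \<Rightarrow> mpoly) set" where
  "Mspace p n g s t Iv =
     {(\<lambda>k. if k \<in> {1..n} then
             red (int p ^ s) (\<Sum>r\<in>{1..t}. \<Sum>l\<in>{1..g}.
                c r l * of_nat (p ^ (s - r)) * Iv r l k)
           else 0) | c.
        \<forall>r\<in>{1..t}. \<forall>l\<in>{1..g}. quasi_const n p r (c r l)}"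

definition M_space :: "nat \<Rightarrow> nat \<Rightarrow> nat \<Rightarrow> nat \<Rightarrow> nat \<Rightarrow> (nat \<Rightarrow> mpoly) set" where
  "M_space p n g s t = Mspace p n g s t (Ivec p n)"

definition Mt_space :: "nat \<Rightarrow> nat \<Rightarrow> nat \<Rightarrow> nat \<Rightarrow> nat \<Rightarrow> (nat \<Rightarrow> mpoly) set" where
  "Mt_space p n g s t = Mspace p n g s t (IvecT p n)"

end

theory Submission
  imports Defs
begin

text \<open>Both families of vectors are instances, for \<open>u = 0\<close> and \<open>u = z\<^sub>n\<close>, of the coefficients in \<open>x\<close>
  of the master polynomial with \<open>x\<close> replaced by \<open>x + u\<close>, for an arbitrary \<open>u \<in> Z[z]\<close>.
  The KZ equations hold modulo \<open>p\<^sup>s\<close> up to an \<open>x\<close>-derivative, and the coefficient of \<open>x\<close> to the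
  power \<open>lp\<^sup>s - 1\<close> in an \<open>x\<close>-derivative is divisible by \<open>p\<^sup>s\<close>.

  For the modules, call \<open>f\<close> admissible of level \<open>r\<close> at \<open>k\<close> if it is a quasi-constant modulo \<open>p\<^sup>r\<close>
  and \<open>p\<^sup>r\<close> divides \<open>k f\<close>; with \<open>p\<^sup>j = gcd(k, p\<^sup>r)\<close> one then has \<open>f = p^(r - j) f'\<close> with \<open>f'\<close> a
  quasi-constant modulo \<open>p\<^sup>j\<close>. Changing \<open>u\<close> expresses the new coefficient vector through the old
  ones (at \<open>x\<close> to the power \<open>k - 1\<close>) with admissible coefficients. Such a term at \<open>k = m p\<^sup>j\<close> is
  reduced from level \<open>r\<close> to level \<open>j\<close> because the two master polynomials differ by a \<open>p\<^sup>j\<close>-th power,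
  whose coefficients are again admissible of level \<open>j\<close>; so induction on the level applies.\<close>

subsection \<open>Derivations\<close>

text \<open>One product-rule calculus serves \<open>pdiff\<close>, \<open>pderiv\<close>, their
  coefficientwise extensions and linear combinations of these.\<close>

definition derivation :: "('a::comm_ring_1 \<Rightarrow> 'a) \<Rightarrow> bool" where
  "derivation D \<longleftrightarrow> (\<forall>x y. D (x + y) = D x + D y) \<and> (\<forall>x y. D (x * y) = x * D y + D x * y)"

lemma derivation_add: "derivation D \<Longrightarrow> D (x + y) = D x + D y"
  and derivation_mult: "derivation D \<Longrightarrow> D (x * y) = x * D y + D x * y"
  by (simp_all add: derivation_def)

lemma derivation_0: "derivation D \<Longrightarrow> D 0 = 0"
  using derivation_add[of D 0 0] by simp

lemma derivation_1: "derivation D \<Longrightarrow> D 1 = 0"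
  using derivation_mult[of D 1 1] by simp

lemma derivation_minus: "derivation D \<Longrightarrow> D (- x) = - D x"
  using derivation_add[of D x "- x"] by (simp add: derivation_0 eq_neg_iff_add_eq_0 add.commute)

lemma derivation_diff: "derivation D \<Longrightarrow> D (x - y) = D x - D y"
  using derivation_add[of D x "- y"] by (simp add: derivation_minus)

lemma derivation_sum: "derivation D \<Longrightarrow> D (\<Sum>i\<in>A. f i) = (\<Sum>i\<in>A. D (f i))"
  by (induction A rule: infinite_finite_induct) (simp_all add: derivation_0 derivation_add)

lemma derivation_of_nat: "derivation D \<Longrightarrow> D (of_nat k) = 0"
  by (induction k) (simp_all add: derivation_0 derivation_add derivation_1)

lemma derivation_power:
  assumes "derivation D"
  shows "D (x ^ m) = of_nat m * x ^ (m - 1) * D x"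
proof (induction m)
  case 0
  show ?case using assms by (simp add: derivation_1)
next
  case (Suc m)
  then show ?case using assms by (cases m) (simp_all add: derivation_mult algebra_simps)
qed

lemma derivation_prod:
  assumes "derivation D" "finite A"
  shows "D (\<Prod>i\<in>A. f i) = (\<Sum>i\<in>A. D (f i) * (\<Prod>j\<in>A - {i}. f j))"
  using assms(2)
proof (induction A rule: finite_induct)
  case empty
  show ?case using assms(1) by (simp add: derivation_1)
next
  case (insert a A)
  have "(\<Prod>j\<in>insert a A - {i}. f j) = f a * (\<Prod>j\<in>A - {i}. f j)" if "i \<in> A" for i
  proof -
    have "insert a A - {i} = insert a (A - {i})" using that insert.hyps by auto
    then show ?thesis using insert.hyps by simp
  qed
  then show ?case
    using insert assms(1)
    by (simp add: derivation_mult sum_distrib_left algebra_simps cong: sum.cong)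
qed

lemma derivation_pderiv: "derivation (pderiv :: 'a::idom poly \<Rightarrow> _)"
  by (simp add: derivation_def pderiv_add pderiv_mult algebra_simps)

lemma derivation_lincomb:
  assumes "derivation D" "derivation E"
  shows "derivation (\<lambda>x. D x + c * E x)"
  using assms by (simp add: derivation_def algebra_simps)

text \<open>Acting on coefficients treats x as a constant; the product rule holds in each term of
  the convolution.\<close>

lemma derivation_map_poly:
  assumes "derivation D"
  shows "derivation (map_poly D)"
proof -
  have [simp]: "D 0 = 0" using assms by (rule derivation_0)
  show ?thesis unfolding derivation_def
    by (auto intro!: poly_eqI
        simp: coeff_map_poly coeff_mult derivation_add[OF assms] derivation_sum[OF assms]
              derivation_mult[OF assms] sum.distrib)
qed

subsection \<open>Integer polynomials\<close>

lemma poly_mapping_eq_sum_single: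
  "f = (\<Sum>m\<in>Poly_Mapping.keys f. Poly_Mapping.single m (Poly_Mapping.lookup f m))"
  by (rule poly_mapping_eqI)
     (auto simp: lookup_sum lookup_single when_def sum.delta' in_keys_iff sum.If_cases)

lemma lookup_pdiff:
  "Poly_Mapping.lookup (pdiff i f) m =
     int (Suc (Poly_Mapping.lookup m i)) * Poly_Mapping.lookup f (m + Poly_Mapping.single i 1)"
proof -
  \<comment> \<open>Subtraction of exponents is truncated, so a monomial free of variable
    \<open>i\<close> could also land on \<open>m\<close>; its factor \<open>lookup m' i\<close> is
    0.\<close>
  have eq: "m' - Poly_Mapping.single i 1 = m \<longleftrightarrow> m' = m + Poly_Mapping.single i 1"
    if "Poly_Mapping.lookup m' i \<noteq> 0" for m'
    using that by (auto simp: poly_mapping_eq_iff fun_eq_iff lookup_minus lookup_add lookup_single when_def)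
  have "Poly_Mapping.lookup (pdiff i f) m =
     (\<Sum>m'\<in>Poly_Mapping.keys f. if m' - Poly_Mapping.single i 1 = m
        then int (Poly_Mapping.lookup m' i) * Poly_Mapping.lookup f m' else 0)"
    by (simp add: pdiff_def lookup_sum lookup_single when_def)
  also have "\<dots> = (\<Sum>m'\<in>Poly_Mapping.keys f. if m' = m + Poly_Mapping.single i 1
        then int (Poly_Mapping.lookup m' i) * Poly_Mapping.lookup f m' else 0)"
    using eq by (intro sum.cong refl) (metis mult_zero_left of_nat_0)
  also have "\<dots> = int (Suc (Poly_Mapping.lookup m i)) * Poly_Mapping.lookup f (m + Poly_Mapping.single i 1)"
    by (simp add: sum.delta' in_keys_iff lookup_add)
  finally show ?thesis .
qed

lemma pdiff_0: "pdiff i 0 = 0"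
  by (simp add: pdiff_def)

lemma pdiff_add: "pdiff i (f + g) = pdiff i f + pdiff i g"
  by (rule poly_mapping_eqI) (simp add: lookup_pdiff lookup_add algebra_simps)

lemma pdiff_single:
  "pdiff i (Poly_Mapping.single m c) =
     Poly_Mapping.single (m - Poly_Mapping.single i 1) (int (Poly_Mapping.lookup m i) * c)"
  by (cases "c = 0") (simp_all add: pdiff_def)

lemma pdiff_mult_single:
  "pdiff i (Poly_Mapping.single m c * Poly_Mapping.single m' c') =
     Poly_Mapping.single m c * pdiff i (Poly_Mapping.single m' c') +
     pdiff i (Poly_Mapping.single m c) * Poly_Mapping.single m' c'"
proof -
  let ?e = "Poly_Mapping.single i (1::nat)"
  \<comment> \<open>The exponents agree only if variable \<open>i\<close> occurs; otherwise the
    coefficient is 0, and both single-term polynomials vanish.\<close>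
  have 1: "m + (m' - ?e) = m + m' - ?e" if "Poly_Mapping.lookup m' i \<noteq> 0"
    using that by (auto simp: poly_mapping_eq_iff fun_eq_iff lookup_minus lookup_add lookup_single when_def)
  have 2: "(m - ?e) + m' = m + m' - ?e" if "Poly_Mapping.lookup m i \<noteq> 0"
    using that by (auto simp: poly_mapping_eq_iff fun_eq_iff lookup_minus lookup_add lookup_single when_def)
  have 3: "Poly_Mapping.single (m + (m' - ?e)) (c * (int (Poly_Mapping.lookup m' i) * c')) =
      Poly_Mapping.single (m + m' - ?e) (c * (int (Poly_Mapping.lookup m' i) * c'))"
    using 1 by (cases "Poly_Mapping.lookup m' i = 0") simp_all
  have 4: "Poly_Mapping.single ((m - ?e) + m') (int (Poly_Mapping.lookup m i) * c * c') =
      Poly_Mapping.single (m + m' - ?e) (int (Poly_Mapping.lookup m i) * c * c')"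
    using 2 by (cases "Poly_Mapping.lookup m i = 0") simp_all
  show ?thesis
    unfolding mult_single pdiff_single 3 4
    by (simp add: lookup_add algebra_simps flip: single_add)
qed

lemma derivation_pdiff: "derivation (pdiff i)"
proof -
  have sum: "pdiff i (\<Sum>a\<in>A. f a) = (\<Sum>a\<in>A. pdiff i (f a))" for A :: "(nat \<Rightarrow>\<^sub>0 nat) set" and f
    by (induction A rule: infinite_finite_induct) (simp_all add: pdiff_add, simp_all add: pdiff_def)
  have "pdiff i (f * g) = f * pdiff i g + pdiff i f * g" for f g
  proof -
    let ?f = "\<lambda>m. Poly_Mapping.single m (Poly_Mapping.lookup f m)"
    let ?g = "\<lambda>m. Poly_Mapping.single m (Poly_Mapping.lookup g m)"
    have "pdiff i ((\<Sum>m\<in>Poly_Mapping.keys f. ?f m) * (\<Sum>m\<in>Poly_Mapping.keys g. ?g m)) =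
        (\<Sum>m\<in>Poly_Mapping.keys f. ?f m) * pdiff i (\<Sum>m\<in>Poly_Mapping.keys g. ?g m) +
        pdiff i (\<Sum>m\<in>Poly_Mapping.keys f. ?f m) * (\<Sum>m\<in>Poly_Mapping.keys g. ?g m)"
      by (simp add: sum_product sum pdiff_mult_single sum.distrib)
    then show ?thesis
      by (simp flip: poly_mapping_eq_sum_single)
  qed
  then show ?thesis by (simp add: derivation_def pdiff_add)
qed

lemma pdiff_Var: "pdiff i (Var j) = (if i = j then 1 else 0)"
  by (auto simp: Var_def pdiff_single lookup_single when_def)

section \<open>Congruence and divisibility of integer polynomials\<close>

lemma lookup_of_int_mult:
  "Poly_Mapping.lookup (of_int c * f) m = c * Poly_Mapping.lookup (f::mpoly) m"
proof -
  \<comment> \<open>\<open>frag_cmul\<close> is integer scaling, whose coefficients are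
    known.\<close>
  have "of_int c * f = frag_cmul c f"
    by (induction c rule: int_induct[of _ 0]) (simp_all add: algebra_simps frag_cmul_distrib frag_cmul_diff_distrib)
  then show ?thesis by simp
qed

text \<open>Turns congruences of coefficients into divisibility in the polynomial ring, the form
  used from here on.\<close>

lemma of_int_dvd_iff:
  "of_int q dvd f \<longleftrightarrow> (\<forall>m. q dvd Poly_Mapping.lookup (f::mpoly) m)"
proof
  assume "of_int q dvd f"
  then show "\<forall>m. q dvd Poly_Mapping.lookup f m"
    by (auto simp: lookup_of_int_mult elim!: dvdE)
next
  assume dvd: "\<forall>m. q dvd Poly_Mapping.lookup f m"
  have "f = of_int q * Poly_Mapping.map (\<lambda>c. c div q) f"
    using dvd by (intro poly_mapping_eqI) (auto simp: lookup_of_int_mult map.rep_eq when_def)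
  then show "of_int q dvd f" by (metis dvd_triv_left)
qed

lemma cong_mp_iff_dvd: "cong_mp q f g \<longleftrightarrow> of_int q dvd f - g"
  by (simp add: cong_mp_def of_int_dvd_iff lookup_minus mod_eq_dvd_iff)

lemma red_eq_iff: "red q f = red q g \<longleftrightarrow> cong_mp q f g"
  unfolding cong_mp_def red_def poly_mapping_eq_iff fun_eq_iff
  by (auto simp: map.rep_eq when_def) (metis mod_0)+

section \<open>Closure properties of the ring in the variables 1 to n\<close>

lemma in_Zz_0: "in_Zz n 0"
  and in_Zz_1: "in_Zz n 1"
  by (simp_all add: in_Zz_def)

lemma in_Zz_Var: "i \<in> {1..n} \<Longrightarrow> in_Zz n (Var i)"
  by (simp add: in_Zz_def Var_def)

lemma in_Zz_add: "in_Zz n f \<Longrightarrow> in_Zz n g \<Longrightarrow> in_Zz n (f + g)"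
  using Poly_Mapping.keys_add[of f g] unfolding in_Zz_def by blast

lemma in_Zz_of_nat: "in_Zz n (of_nat k)"
  by (induction k) (simp_all add: in_Zz_0 in_Zz_1 in_Zz_add)

lemma in_Zz_minus: "in_Zz n f \<Longrightarrow> in_Zz n (- f)"
  by (simp add: in_Zz_def)

lemma in_Zz_diff: "in_Zz n f \<Longrightarrow> in_Zz n g \<Longrightarrow> in_Zz n (f - g)"
  using in_Zz_add[of n f "- g"] by (simp add: in_Zz_minus)

lemma in_Zz_mult:
  assumes "in_Zz n f" "in_Zz n g"
  shows "in_Zz n (f * g)"
  unfolding in_Zz_def
proof
  fix m assume "m \<in> Poly_Mapping.keys (f * g)"
  then obtain a b where "m = a + b" "a \<in> Poly_Mapping.keys f" "b \<in> Poly_Mapping.keys g"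
    using Poly_Mapping.keys_mult[of f g] by auto
  then show "Poly_Mapping.keys m \<subseteq> {1..n}"
    using assms Poly_Mapping.keys_add[of a b] unfolding in_Zz_def by blast
qed

lemma in_Zz_power: "in_Zz n f \<Longrightarrow> in_Zz n (f ^ k)"
  by (induction k) (simp_all add: in_Zz_1 in_Zz_mult)

lemma in_Zz_sum: "(\<And>i. i \<in> A \<Longrightarrow> in_Zz n (f i)) \<Longrightarrow> in_Zz n (\<Sum>i\<in>A. f i)"
  by (induction A rule: infinite_finite_induct) (simp_all add: in_Zz_0 in_Zz_add)

definition in_Zzx :: "nat \<Rightarrow> mpoly poly \<Rightarrow> bool" where
  "in_Zzx n P \<longleftrightarrow> (\<forall>k. in_Zz n (coeff P k))"

lemma in_Zzx_mult: "in_Zzx n P \<Longrightarrow> in_Zzx n Q \<Longrightarrow> in_Zzx n (P * Q)"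
  by (simp add: in_Zzx_def coeff_mult in_Zz_sum in_Zz_mult)

lemma in_Zzx_1: "in_Zzx n 1"
  by (simp add: in_Zzx_def in_Zz_0 in_Zz_1 flip: one_pCons)

lemma in_Zzx_power: "in_Zzx n P \<Longrightarrow> in_Zzx n (P ^ k)"
  by (induction k) (simp_all add: in_Zzx_1 in_Zzx_mult)

lemma in_Zzx_prod: "(\<And>i. i \<in> A \<Longrightarrow> in_Zzx n (f i)) \<Longrightarrow> in_Zzx n (\<Prod>i\<in>A. f i)"
  by (induction A rule: infinite_finite_induct) (simp_all add: in_Zzx_1 in_Zzx_mult)

subsection \<open>Shifted master polynomials and the KZ equations\<close>

definition lin :: "mpoly \<Rightarrow> nat \<Rightarrow> mpoly poly" where
  "lin u i = [:u - Var i, 1:]"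

definition shcomp :: "mpoly \<Rightarrow> nat \<Rightarrow> nat \<Rightarrow> nat \<Rightarrow> mpoly poly" where
  "shcomp u n M a = lin u a ^ (M - 1) * (\<Prod>i\<in>{1..n} - {a}. lin u i ^ M)"

text \<open>For \<open>a \<noteq> b\<close> and \<open>M \<ge> 1\<close> this is the shifted master
  polynomial divided by both linear factors at \<open>a\<close> and \<open>b\<close>.\<close>

definition shpair :: "mpoly \<Rightarrow> nat \<Rightarrow> nat \<Rightarrow> nat \<Rightarrow> nat \<Rightarrow> mpoly poly" where
  "shpair u n M a b =
     lin u a ^ (M - 1) * lin u b ^ (M - 1) * (\<Prod>i\<in>{1..n} - {a, b}. lin u i ^ M)"

lemma prod_Diff_insert:
  assumes "finite A" "b \<in> A" "a \<noteq> b"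
  shows "(\<Prod>i\<in>A - {a}. f i) = f b * (\<Prod>i\<in>A - {a, b}. f i)"
proof -
  have "A - {a} = insert b (A - {a, b})" using assms by auto
  moreover have "finite (A - {a, b})" "b \<notin> A - {a, b}" using assms by auto
  ultimately show ?thesis by (metis prod.insert)
qed

lemma shcomp_eq_lin_mult:
  assumes "M \<ge> 1" "b \<in> {1..n}" "a \<noteq> b"
  shows "shcomp u n M a = lin u b * shpair u n M a b"
proof -
  have "lin u b ^ M = lin u b * lin u b ^ (M - 1)"
    using assms(1) by (cases M) auto
  then show ?thesis
    unfolding shcomp_def shpair_def prod_Diff_insert[OF finite_atLeastAtMost assms(2,3)]
    by (simp only: mult_ac)
qed

lemma shpair_commute: "shpair u n M a b = shpair u n M b a"
  by (simp add: shpair_def insert_commute mult.commute)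

text \<open>Partial fractions: 1/(x-z_b) - 1/(x-z_a) = (z_b-z_a)/((x-z_a)(x-z_b)). The factor
  produced cancels the pole in the KZ equation.\<close>

lemma coeff_shcomp_diff:
  assumes "M \<ge> 1" "a \<in> {1..n}" "b \<in> {1..n}" "a \<noteq> b"
  shows "coeff (shcomp u n M b) N - coeff (shcomp u n M a) N =
     (Var b - Var a) * coeff (shpair u n M a b) N"
proof -
  have "shcomp u n M b - shcomp u n M a = (lin u a - lin u b) * shpair u n M a b"
    using assms shcomp_eq_lin_mult[of M b n a u] shcomp_eq_lin_mult[of M a n b u]
    by (simp add: algebra_simps shpair_commute[of u n M b a])
  also have "lin u a - lin u b = [:Var b - Var a:]"
    by (simp add: lin_def)
  finally have "coeff (shcomp u n M b - shcomp u n M a) N = (Var b - Var a) * coeff (shpair u n M a b) N"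
    by simp
  then show ?thesis by simp
qed

text \<open>On the shifted linear factors \<open>x + u - z\<^sub>j\<close> this derivation acts as the partial
  derivative in \<open>z\<^sub>i\<close> with \<open>u\<close> treated as a constant.\<close>

definition shdiff :: "mpoly \<Rightarrow> nat \<Rightarrow> mpoly poly \<Rightarrow> mpoly poly" where
  "shdiff u i P = map_poly (pdiff i) P + [:- pdiff i u:] * pderiv P"

lemma derivation_shdiff: "derivation (shdiff u i)"
  unfolding shdiff_def[abs_def]
  by (intro derivation_lincomb derivation_map_poly derivation_pdiff derivation_pderiv)

lemma shdiff_lin: "shdiff u i (lin u j) = (if i = j then - 1 else 0)"
  by (auto simp: shdiff_def lin_def map_poly_pCons pdiff_0 derivation_diff[OF derivation_pdiff]
      derivation_1[OF derivation_pdiff] pdiff_Var pderiv_pCons one_pCons)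

lemma pderiv_lin: "pderiv (lin u j) = 1"
  by (simp add: lin_def pderiv_pCons one_pCons)

text \<open>For \<open>a \<noteq> i\<close> only the factor \<open>lin u i ^ M\<close> depends on
  z_i.\<close>

lemma shdiff_shcomp_neq:
  assumes "M \<ge> 1" "i \<in> {1..n}" "a \<noteq> i"
  shows "shdiff u i (shcomp u n M a) = - (of_nat M * shpair u n M a i)"
proof -
  let ?D = "shdiff u i"
  note D = derivation_shdiff[of u i]
  let ?R = "\<Prod>j\<in>{1..n} - {a, i}. lin u j ^ M"
  have "?D ?R = 0"
    by (auto simp: derivation_prod[OF D] derivation_power[OF D] shdiff_lin intro!: sum.neutral)
  moreover have "?D (lin u a ^ (M - 1)) = 0"
    using assms(3) by (simp add: derivation_power[OF D] shdiff_lin)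
  moreover have "?D (lin u i ^ M) = - (of_nat M * lin u i ^ (M - 1))"
    by (simp add: derivation_power[OF D] shdiff_lin)
  ultimately show ?thesis
    unfolding shcomp_def shpair_def prod_Diff_insert[OF finite_atLeastAtMost assms(2,3)]
    by (simp add: derivation_mult[OF D] algebra_simps)
qed

lemma shdiff_shcomp_eq:
  "shdiff u i (shcomp u n M i) + pderiv (shcomp u n M i) =
     of_nat M * (\<Sum>j\<in>{1..n} - {i}. shpair u n M i j)"
proof -
  \<comment> \<open>Adding the x-derivative makes \<open>D\<close> vanish on \<open>lin u i\<close>
    and take the value 1 on every other linear factor, so exactly the factors with
    \<open>j \<noteq> i\<close> contribute.\<close>
  define D where "D = (\<lambda>P. shdiff u i P + 1 * pderiv P)"
  have D: "derivation D"
    unfolding D_def by (intro derivation_lincomb derivation_shdiff derivation_pderiv)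
  have lin: "D (lin u j) = (if i = j then 0 else 1)" for j
    by (simp add: D_def shdiff_lin pderiv_lin)
  have "D (\<Prod>j\<in>{1..n} - {i}. lin u j ^ M) =
      (\<Sum>j\<in>{1..n} - {i}. of_nat M * lin u j ^ (M - 1) * (\<Prod>k\<in>{1..n} - {i, j}. lin u k ^ M))"
    unfolding derivation_prod[OF D finite_Diff[OF finite_atLeastAtMost]]
    by (intro sum.cong refl) (auto simp: derivation_power[OF D] lin Diff_insert2[symmetric])
  moreover have "D (lin u i ^ (M - 1)) = 0"
    by (simp add: derivation_power[OF D] lin)
  ultimately have "D (shcomp u n M i) = of_nat M * (\<Sum>j\<in>{1..n} - {i}. shpair u n M i j)"
    unfolding shcomp_def shpair_def
    by (simp add: derivation_mult[OF D] sum_distrib_left algebra_simps)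
  then show ?thesis by (simp add: D_def)
qed

lemma pderiv_shcomp_sum:
  "pderiv (\<Prod>j\<in>{1..n}. lin u j ^ M) = of_nat M * (\<Sum>a\<in>{1..n}. shcomp u n M a)"
  by (simp add: derivation_prod[OF derivation_pderiv] derivation_power[OF derivation_pderiv]
      pderiv_lin shcomp_def sum_distrib_left mult.assoc)

lemma coeff_of_nat_mult: "coeff (of_nat k * P) N = of_nat k * coeff P N"
  for P :: "'a::comm_ring_1 poly"
  by (simp add: of_nat_poly)

lemma Omega_sum:
  assumes "i \<in> {1..n}" "j \<in> {1..n}" "i \<noteq> j"
  shows "(\<Sum>b\<in>{1..n}. of_int (Omega i j a b) * I b) =
    (if a = i then I j - I i else if a = j then I i - I j else (0::'a::comm_ring_1))"
proof -
  have "(\<Sum>b\<in>{1..n}. of_int (Omega i j a b) * I b) =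
      (\<Sum>b\<in>{1..n}. (if b = i then (if a = i then - I b else if a = j then I b else 0) else 0) +
                    (if b = j then (if a = j then - I b else if a = i then I b else 0) else 0))"
    using assms(3) by (intro sum.cong refl) (auto simp: Omega_def)
  also have "\<dots> = (if a = i then I j - I i else if a = j then I i - I j else 0)"
    using assms by (auto simp: sum.distrib)
  finally show ?thesis .
qed

text \<open>Differentiation multiplies the coefficient of x to the power N+1 by N+1, a multiple of
  \<open>q\<close>.\<close>

lemma dvd_coeff_pderiv:
  assumes "N + 1 = l * q"
  shows "of_nat q dvd coeff (pderiv P) N"
proof -
  have "coeff (pderiv P) N = of_nat (l * q) * coeff P (Suc N)"
    by (simp add: coeff_pderiv flip: assms)
  then show ?thesis by simp
qed

text \<open>Since 2M is congruent to -1 modulo q, the exponent M acts like -1/2, which matches the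
  factor 1/2 of the KZ system; the x-derivatives that remain drop out at the coefficient N.\<close>

lemma KZ_sol_mod_coeff_shcomp:
  assumes M: "M \<ge> 1" "q = 2 * M + 1" and N: "N + 1 = l * q"
  shows "KZ_sol_mod (int q) n (\<lambda>a. coeff (shcomp u n M a) N)"
proof -
  let ?I = "\<lambda>a. coeff (shcomp u n M a) N"
  let ?G = "\<lambda>a b. coeff (shpair u n M a b) N"
  have two_M: "2 * of_nat M = of_nat q - (1::mpoly)"
    by (simp add: M(2))
  have coeff_shdiff: "coeff (shdiff u i P) N = pdiff i (coeff P N) - pdiff i u * coeff (pderiv P) N"
    for i P
    by (simp add: shdiff_def coeff_map_poly pdiff_0)
  \<comment> \<open>The off-diagonal equation with its pole cancelled: \<open>?G a i\<close> stands
    for (I_i - I_a)/(z_i - z_a).\<close>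
  have neq: "of_nat q dvd 2 * pdiff i (?I a) - ?G a i" if "i \<in> {1..n}" "a \<noteq> i" for i a
  proof -
    have "coeff (shdiff u i (shcomp u n M a)) N = - (of_nat M * ?G a i)"
      using shdiff_shcomp_neq[OF M(1) that] by (simp add: coeff_of_nat_mult)
    then have "pdiff i (?I a) = pdiff i u * coeff (pderiv (shcomp u n M a)) N - of_nat M * ?G a i"
      unfolding coeff_shdiff by (simp add: algebra_simps)
    then have "2 * pdiff i (?I a) - ?G a i =
        2 * pdiff i u * coeff (pderiv (shcomp u n M a)) N - (2 * of_nat M + 1) * ?G a i"
      by (simp only:) (simp add: algebra_simps)
    also have "of_nat q dvd \<dots>"
      by (rule dvd_diff[OF dvd_mult[OF dvd_coeff_pderiv[OF N]] dvd_mult2]) (simp add: two_M)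
    finally show ?thesis .
  qed
  \<comment> \<open>The diagonal equation, in which every \<open>j \<noteq> i\<close>
    contributes.\<close>
  have eq: "of_nat q dvd 2 * pdiff i (?I i) + (\<Sum>j\<in>{1..n} - {i}. ?G i j)" for i
  proof -
    let ?P = "coeff (pderiv (shcomp u n M i)) N"
    let ?S = "\<Sum>j\<in>{1..n} - {i}. ?G i j"
    have "coeff (shdiff u i (shcomp u n M i)) N + ?P = of_nat M * ?S"
      using arg_cong[OF shdiff_shcomp_eq[of u i n M], of "\<lambda>P. coeff P N"]
      by (simp add: coeff_of_nat_mult coeff_sum)
    then have "pdiff i (?I i) = of_nat M * ?S - ?P + pdiff i u * ?P"
      unfolding coeff_shdiff by (simp add: algebra_simps)
    then have "2 * pdiff i (?I i) + ?S = (2 * of_nat M + 1) * ?S + (2 * pdiff i u - 2) * ?P"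
      by (simp only:) (simp add: algebra_simps)
    also have "of_nat q dvd \<dots>"
      by (rule dvd_add[OF dvd_mult2 dvd_mult[OF dvd_coeff_pderiv[OF N]]]) (simp add: two_M)
    finally show ?thesis .
  qed
  have sum0: "of_nat q dvd (\<Sum>a\<in>{1..n}. ?I a)"
  proof -
    have "of_nat q dvd coeff (pderiv (\<Prod>j\<in>{1..n}. lin u j ^ M)) N"
      by (rule dvd_coeff_pderiv[OF N])
    then have "of_nat q dvd of_nat M * (\<Sum>a\<in>{1..n}. ?I a)"
      unfolding pderiv_shcomp_sum coeff_of_nat_mult coeff_sum .
    \<comment> \<open>The combination q - 2M = 1 removes the factor M.\<close>
    then have "of_nat q dvd of_nat q * (\<Sum>a\<in>{1..n}. ?I a) - 2 * (of_nat M * (\<Sum>a\<in>{1..n}. ?I a))"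
      by (rule dvd_diff[OF dvd_triv_left dvd_mult])
    also have "\<dots> = (of_nat q - 2 * of_nat M) * (\<Sum>a\<in>{1..n}. ?I a)"
      by (simp only: algebra_simps)
    finally show ?thesis by (simp add: two_M)
  qed
  have "of_nat q dvd 2 * (\<Prod>j\<in>{1..n} - {i}. Var i - Var j) * pdiff i (?I a) -
      (\<Sum>j\<in>{1..n} - {i}. (\<Prod>k\<in>{1..n} - {i, j}. Var i - Var k) *
          (\<Sum>b\<in>{1..n}. of_int (Omega i j a b) * ?I b))"
    if i: "i \<in> {1..n}" and a: "a \<in> {1..n}" for i a
  proof (cases "a = i")
    case False
    let ?W = "\<Prod>k\<in>{1..n} - {i, a}. Var i - Var k"
    have W: "(\<Prod>j\<in>{1..n} - {i}. Var i - Var j) = (Var i - Var a) * ?W"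
      using False a by (intro prod_Diff_insert) auto
    \<comment> \<open>In row \<open>a \<noteq> i\<close> only the matrix with \<open>j = a\<close>
      is nonzero.\<close>
    have "(\<Sum>b\<in>{1..n}. of_int (Omega i j a b) * ?I b) = (if j = a then ?I i - ?I a else 0)"
      if "j \<in> {1..n} - {i}" for j
      using False i that by (subst Omega_sum) auto
    then have "(\<Sum>j\<in>{1..n} - {i}. (\<Prod>k\<in>{1..n} - {i, j}. Var i - Var k) *
          (\<Sum>b\<in>{1..n}. of_int (Omega i j a b) * ?I b)) =
        (\<Sum>j\<in>{1..n} - {i}. if j = a then ?W * (?I i - ?I a) else 0)"
      by (intro sum.cong refl) simp
    also have "\<dots> = ?W * ((Var i - Var a) * ?G a i)"
      using False a i by (simp add: coeff_shcomp_diff[OF M(1)])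
    finally have "2 * (\<Prod>j\<in>{1..n} - {i}. Var i - Var j) * pdiff i (?I a) -
      (\<Sum>j\<in>{1..n} - {i}. (\<Prod>k\<in>{1..n} - {i, j}. Var i - Var k) *
          (\<Sum>b\<in>{1..n}. of_int (Omega i j a b) * ?I b)) =
        (Var i - Var a) * ?W * (2 * pdiff i (?I a) - ?G a i)"
      unfolding W by (simp add: algebra_simps)
    then show ?thesis using neq[OF i False] by simp
  next
    case True
    let ?W = "\<Prod>j\<in>{1..n} - {i}. Var i - Var j"
    have "(\<Prod>k\<in>{1..n} - {i, j}. Var i - Var k) * (\<Sum>b\<in>{1..n}. of_int (Omega i j i b) * ?I b)
        = - ?W * ?G i j" if j: "j \<in> {1..n} - {i}" for j
    proof -
      have W: "?W = (Var i - Var j) * (\<Prod>k\<in>{1..n} - {i, j}. Var i - Var k)"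
        using j by (intro prod_Diff_insert) auto
      have "(\<Sum>b\<in>{1..n}. of_int (Omega i j i b) * ?I b) = ?I j - ?I i"
        using i j by (subst Omega_sum) auto
      also have "\<dots> = (Var j - Var i) * ?G i j"
        using i j by (subst coeff_shcomp_diff[OF M(1)]) auto
      finally show ?thesis unfolding W by (simp only:) (simp add: algebra_simps)
    qed
    then have "(\<Sum>j\<in>{1..n} - {i}. (\<Prod>k\<in>{1..n} - {i, j}. Var i - Var k) *
          (\<Sum>b\<in>{1..n}. of_int (Omega i j i b) * ?I b)) = - ?W * (\<Sum>j\<in>{1..n} - {i}. ?G i j)"
      by (simp add: sum_distrib_left del: mult_minus_left)
    then have "2 * ?W * pdiff i (?I a) -
      (\<Sum>j\<in>{1..n} - {i}. (\<Prod>k\<in>{1..n} - {i, j}. Var i - Var k) *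
          (\<Sum>b\<in>{1..n}. of_int (Omega i j a b) * ?I b)) =
        ?W * (2 * pdiff i (?I i) + (\<Sum>j\<in>{1..n} - {i}. ?G i j))"
      unfolding True by (simp only:) (simp add: algebra_simps)
    then show ?thesis using eq[of i] by simp
  qed
  then show ?thesis
    using sum0 unfolding KZ_sol_mod_def cong_mp_iff_dvd by simp
qed

subsection \<open>Quasi-constants\<close>

lemma quasi_const_iff_dvd:
  "quasi_const n p r f \<longleftrightarrow> in_Zz n f \<and> (\<forall>i\<in>{1..n}. of_nat (p ^ r) dvd pdiff i f)"
  using of_int_dvd_iff[of "int (p ^ r)"] by (simp add: quasi_const_def)

lemma quasi_const_0: "quasi_const n p r 0"
  by (simp add: quasi_const_iff_dvd in_Zz_0 pdiff_0)

lemma quasi_const_1: "quasi_const n p r 1"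
  by (simp add: quasi_const_iff_dvd in_Zz_1 derivation_1[OF derivation_pdiff])

lemma quasi_const_add: "quasi_const n p r f \<Longrightarrow> quasi_const n p r g \<Longrightarrow> quasi_const n p r (f + g)"
  by (simp add: quasi_const_iff_dvd in_Zz_add derivation_add[OF derivation_pdiff])

lemma quasi_const_mult: "quasi_const n p r f \<Longrightarrow> quasi_const n p r g \<Longrightarrow> quasi_const n p r (f * g)"
  by (simp add: quasi_const_iff_dvd in_Zz_mult derivation_mult[OF derivation_pdiff])

lemma quasi_const_mono:
  assumes "quasi_const n p r f" "r' \<le> r"
  shows "quasi_const n p r' f"
proof -
  have "of_nat (p ^ r') dvd (of_nat (p ^ r) :: mpoly)"
    using assms(2) by (simp add: le_imp_power_dvd)
  then show ?thesis
    using assms(1) unfolding quasi_const_iff_dvd by (meson dvd_trans)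
qed

lemma lookup_of_nat_mult:
  "Poly_Mapping.lookup (of_nat c * f) m = int c * Poly_Mapping.lookup (f::mpoly) m"
  using lookup_of_int_mult[of "int c"] by simp

lemma of_nat_dvd_iff:
  "of_nat q dvd f \<longleftrightarrow> (\<forall>m. int q dvd Poly_Mapping.lookup (f::mpoly) m)"
  using of_int_dvd_iff[of "int q"] by simp

section \<open>Admissible coefficients\<close>

definition admissible :: "nat \<Rightarrow> nat \<Rightarrow> nat \<Rightarrow> nat \<Rightarrow> mpoly \<Rightarrow> bool" where
  "admissible n p r k f \<longleftrightarrow> quasi_const n p r f \<and> of_nat (p ^ r) dvd of_nat k * f"

lemma admissible_decomp:
  assumes "prime p" "admissible n p r k f"
  obtains j f' where "j \<le> r" "p ^ j dvd k" "f = of_nat (p ^ (r - j)) * f'" "quasi_const n p j f'"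
proof -
  have p: "p > 0" using assms(1) prime_gt_0_nat by blast
  have qc: "quasi_const n p r f" and dvd: "of_nat (p ^ r) dvd of_nat k * f"
    using assms(2) by (auto simp: admissible_def)
  have "gcd k (p ^ r) dvd p ^ r" by simp
  then obtain j where j: "j \<le> r" "gcd k (p ^ r) = p ^ j"
    using divides_primepow_nat[OF assms(1)] by blast
  have pr: "p ^ r = p ^ j * p ^ (r - j)"
    using j(1) by (simp flip: power_add)
  obtain k' where k': "k = p ^ j * k'" by (metis dvdE gcd_dvd1 j(2))
  have "p ^ j * gcd k' (p ^ (r - j)) = p ^ j * 1"
    using j(2) unfolding pr by (subst (asm) k') (simp add: gcd_mult_distrib_nat)
  \<comment> \<open>With the gcd \<open>p ^ j\<close> divided out, the cofactor of \<open>k\<close>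
    is coprime to \<open>p ^ (r - j)\<close>, so this power must divide every coefficient of
    \<open>f\<close>.\<close>
  then have "coprime k' (p ^ (r - j))"
    using p by (simp add: coprime_iff_gcd_eq_1)
  then have cop: "coprime (int (p ^ (r - j))) (int k')"
    by (metis coprime_int_iff coprime_commute)
  have "int (p ^ (r - j)) dvd Poly_Mapping.lookup f m" for m
  proof -
    have "int (p ^ j) * int (p ^ (r - j)) dvd int (p ^ j) * (int k' * Poly_Mapping.lookup f m)"
      using dvd unfolding of_nat_dvd_iff lookup_of_nat_mult
      by (simp only: pr k' of_nat_mult mult.assoc)
    then have "int (p ^ (r - j)) dvd int k' * Poly_Mapping.lookup f m"
      using p by simp
    then show ?thesis
      using cop coprime_dvd_mult_right_iff by blast
  qed
  then obtain f' where f': "f = of_nat (p ^ (r - j)) * f'"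
    using of_nat_dvd_iff[of "p ^ (r - j)" f] by (auto elim: dvdE)
  \<comment> \<open>Scaling by a nonzero integer keeps the support, so the quotient stays in
    Z[z].\<close>
  have "Poly_Mapping.keys f = Poly_Mapping.keys f'"
    using p unfolding f' by (auto simp: in_keys_iff lookup_of_nat_mult simp del: of_nat_power)
  then have "in_Zz n f'"
    using qc by (simp add: quasi_const_def in_Zz_def)
  moreover have "of_nat (p ^ j) dvd pdiff i f'" if "i \<in> {1..n}" for i
  proof -
    have "of_nat (p ^ r) dvd of_nat (p ^ (r - j)) * pdiff i f'"
      using qc that unfolding quasi_const_iff_dvd f'
      by (simp add: derivation_mult[OF derivation_pdiff] derivation_of_nat[OF derivation_pdiff] del: of_nat_power)
    then have "int (p ^ j) * int (p ^ (r - j)) dvd int (p ^ (r - j)) * Poly_Mapping.lookup (pdiff i f') m" for m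
      using p unfolding of_nat_dvd_iff lookup_of_nat_mult pr by simp
    then show ?thesis
      using p unfolding of_nat_dvd_iff by simp
  qed
  ultimately have "quasi_const n p j f'" by (simp add: quasi_const_iff_dvd)
  then show thesis using that j gcd_dvd1[of k "p ^ r"] f' by metis
qed

text \<open>These are the coefficients in the change of shift. Divisibility comes from (m+1) C(m,N)
  = (N+1) C(m+1,N+1); subtracting (N+1) C(m,N) gives (m-N) C(m,N), the factor that appears when the
  power of \<open>w\<close> is differentiated.\<close>

lemma admissible_binomial:
  assumes "in_Zz n w" "N + 1 = l * p ^ r"
  shows "admissible n p r (Suc m) (of_nat (m choose N) * w ^ (m - N))"
proof -
  let ?b = "m choose N"
  have b: "p ^ r dvd Suc m * ?b"
    using Suc_times_binomial[of N m] assms(2) by (metis Suc_eq_plus1 dvd_mult2 dvd_triv_right)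
  have "p ^ r dvd ?b * (m - N)"
  proof (cases "N \<le> m")
    case True
    have "p ^ r dvd Suc N * ?b" using assms(2) by simp
    then have "p ^ r dvd Suc m * ?b - Suc N * ?b"
      using b by (rule dvd_diff_nat[rotated])
    also have "Suc m * ?b - Suc N * ?b = ?b * (m - N)"
      by (simp add: algebra_simps diff_mult_distrib2)
    finally show ?thesis .
  qed simp
  then have "of_nat (p ^ r) dvd (of_nat (?b * (m - N)) :: mpoly)"
    by (metis dvdE dvd_triv_left of_nat_mult)
  then have "of_nat (p ^ r) dvd of_nat (?b * (m - N)) * (w ^ (m - N - 1) * pdiff i w)" for i
    by (rule dvd_mult2)
  then have "of_nat (p ^ r) dvd pdiff i (of_nat ?b * w ^ (m - N))" for i
    by (simp add: derivation_mult[OF derivation_pdiff] derivation_of_nat[OF derivation_pdiff]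
        derivation_power[OF derivation_pdiff] mult.assoc)
  moreover have "in_Zz n (of_nat ?b)"
    by (rule in_Zz_of_nat)
  moreover have "of_nat (p ^ r) dvd (of_nat (Suc m * ?b) :: mpoly)"
    using b by (metis dvdE dvd_triv_left of_nat_mult)
  then have "of_nat (p ^ r) dvd of_nat (Suc m) * (of_nat ?b * w ^ (m - N))"
    unfolding of_nat_mult mult.assoc[symmetric] by (rule dvd_mult2)
  ultimately show ?thesis
    using assms(1) unfolding admissible_def quasi_const_iff_dvd
    by (intro conjI ballI in_Zz_mult in_Zz_power)
qed

text \<open>Any derivation of a \<open>p ^ r\<close>-th power carries the factor
  \<open>p ^ r\<close>. The partial derivatives give the quasi-constant condition, the x-derivative
  gives the condition on \<open>k\<close>.\<close>

lemma admissible_coeff_power: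
  assumes "in_Zzx n P"
  shows "admissible n p r k (coeff (P ^ (p ^ r)) k)"
proof -
  have D: "of_nat (p ^ r) dvd coeff (D (P ^ (p ^ r))) k" if "derivation D" for D k
    by (simp add: derivation_power[OF that] mult.assoc coeff_of_nat_mult del: of_nat_power)
  have "of_nat (p ^ r) dvd pdiff i (coeff (P ^ (p ^ r)) k)" for i
    using D[OF derivation_map_poly[OF derivation_pdiff], of i k] by (simp add: coeff_map_poly pdiff_0)
  moreover have "of_nat (p ^ r) dvd of_nat k * coeff (P ^ (p ^ r)) k"
    using D[OF derivation_pderiv, of "k - 1"] by (cases k) (simp_all add: coeff_pderiv)
  ultimately show ?thesis
    using in_Zzx_power[OF assms] by (simp add: admissible_def quasi_const_iff_dvd in_Zzx_def)
qed

lemma admissible_complement: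
  assumes "admissible n p r k f" "k \<le> m * p ^ r"
  shows "admissible n p r (m * p ^ r - k) f"
proof -
  have "of_nat (p ^ r) dvd of_nat (m * p ^ r) * f - of_nat k * f"
    using assms(1) by (intro dvd_diff) (auto simp: admissible_def)
  then have "of_nat (p ^ r) dvd of_nat (m * p ^ r - k) * f"
    using assms(2) by (simp only: of_nat_diff left_diff_distrib)
  then show ?thesis using assms(1) by (simp add: admissible_def)
qed

subsection \<open>The modules of solutions\<close>

text \<open>Membership for integral lifts: \<open>w\<close> is an unreduced vector and only its
  class modulo \<open>p ^ s\<close> at the indices 1 to n counts.\<close>

definition kspan ::
  "nat \<Rightarrow> nat \<Rightarrow> nat \<Rightarrow> nat \<Rightarrow> nat \<Rightarrow> (nat \<Rightarrow> nat \<Rightarrow> nat \<Rightarrow> mpoly) \<Rightarrow> (nat \<Rightarrow> mpoly) \<Rightarrow> bool" where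
  "kspan p n g s t Iv w \<longleftrightarrow>
     (\<exists>c. (\<forall>r\<in>{1..t}. \<forall>l\<in>{1..g}. quasi_const n p r (c r l)) \<and>
          (\<forall>k\<in>{1..n}. of_nat (p ^ s) dvd
             w k - (\<Sum>r\<in>{1..t}. \<Sum>l\<in>{1..g}. c r l * of_nat (p ^ (s - r)) * Iv r l k)))"

lemma Mspace_eq_kspan:
  "Mspace p n g s t Iv =
     {(\<lambda>k. if k \<in> {1..n} then red (int p ^ s) (w k) else 0) | w. kspan p n g s t Iv w}"
  (is "?L = ?R")
proof
  show "?L \<subseteq> ?R"
  proof
    fix v assume "v \<in> ?L"
    then obtain c where c: "\<forall>r\<in>{1..t}. \<forall>l\<in>{1..g}. quasi_const n p r (c r l)"
      and v: "v = (\<lambda>k. if k \<in> {1..n} then red (int p ^ s)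
        (\<Sum>r\<in>{1..t}. \<Sum>l\<in>{1..g}. c r l * of_nat (p ^ (s - r)) * Iv r l k) else 0)"
      unfolding Mspace_def by blast
    have "kspan p n g s t Iv (\<lambda>k. \<Sum>r\<in>{1..t}. \<Sum>l\<in>{1..g}. c r l * of_nat (p ^ (s - r)) * Iv r l k)"
      unfolding kspan_def using c by (intro exI[of _ c]) simp
    then show "v \<in> ?R" unfolding v by (intro CollectI exI conjI) (rule refl)
  qed
  show "?R \<subseteq> ?L"
  proof
    fix v assume "v \<in> ?R"
    then obtain w c where v: "v = (\<lambda>k. if k \<in> {1..n} then red (int p ^ s) (w k) else 0)"
      and c: "\<forall>r\<in>{1..t}. \<forall>l\<in>{1..g}. quasi_const n p r (c r l)"
      and w: "\<forall>k\<in>{1..n}. of_nat (p ^ s) dvd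
             w k - (\<Sum>r\<in>{1..t}. \<Sum>l\<in>{1..g}. c r l * of_nat (p ^ (s - r)) * Iv r l k)"
      unfolding kspan_def by blast
    have "v = (\<lambda>k. if k \<in> {1..n} then red (int p ^ s)
        (\<Sum>r\<in>{1..t}. \<Sum>l\<in>{1..g}. c r l * of_nat (p ^ (s - r)) * Iv r l k) else 0)"
      unfolding v using w by (intro ext if_cong refl) (simp add: red_eq_iff cong_mp_iff_dvd)
    then show "v \<in> ?L" unfolding Mspace_def using c by blast
  qed
qed

lemma kspan_cong_dvd:
  assumes "kspan p n g s t Iv w" "\<And>k. k \<in> {1..n} \<Longrightarrow> of_nat (p ^ s) dvd w' k - w k"
  shows "kspan p n g s t Iv w'"
proof -
  obtain c where c: "\<forall>r\<in>{1..t}. \<forall>l\<in>{1..g}. quasi_const n p r (c r l)"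
    and w: "\<forall>k\<in>{1..n}. of_nat (p ^ s) dvd
             w k - (\<Sum>r\<in>{1..t}. \<Sum>l\<in>{1..g}. c r l * of_nat (p ^ (s - r)) * Iv r l k)"
    using assms(1) unfolding kspan_def by blast
  have "of_nat (p ^ s) dvd
      w' k - (\<Sum>r\<in>{1..t}. \<Sum>l\<in>{1..g}. c r l * of_nat (p ^ (s - r)) * Iv r l k)"
    if "k \<in> {1..n}" for k
    using dvd_add[OF assms(2)[OF that] bspec[OF w that]] by simp
  then show ?thesis unfolding kspan_def using c by blast
qed

lemma kspan_0: "kspan p n g s t Iv (\<lambda>_. 0)"
  unfolding kspan_def by (intro exI[of _ "\<lambda>_ _. 0"]) (simp add: quasi_const_0)

lemma kspan_add:
  assumes "kspan p n g s t Iv v" "kspan p n g s t Iv w"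
  shows "kspan p n g s t Iv (\<lambda>k. v k + w k)"
proof -
  let ?S = "\<lambda>c k. \<Sum>r\<in>{1..t}. \<Sum>l\<in>{1..g}. c r l * of_nat (p ^ (s - r)) * Iv r l k"
  obtain c d where "\<forall>r\<in>{1..t}. \<forall>l\<in>{1..g}. quasi_const n p r (c r l)"
      "\<forall>r\<in>{1..t}. \<forall>l\<in>{1..g}. quasi_const n p r (d r l)"
    and cd: "\<forall>k\<in>{1..n}. of_nat (p ^ s) dvd v k - ?S c k"
      "\<forall>k\<in>{1..n}. of_nat (p ^ s) dvd w k - ?S d k"
    using assms unfolding kspan_def by blast
  then have "\<forall>r\<in>{1..t}. \<forall>l\<in>{1..g}. quasi_const n p r (c r l + d r l)"
    by (simp add: quasi_const_add)
  moreover have "of_nat (p ^ s) dvd (v k + w k) - ?S (\<lambda>r l. c r l + d r l) k" if "k \<in> {1..n}" for k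
  proof -
    have "?S (\<lambda>r l. c r l + d r l) k = ?S c k + ?S d k"
      by (simp add: distrib_right sum.distrib)
    then have "(v k + w k) - ?S (\<lambda>r l. c r l + d r l) k = (v k - ?S c k) + (w k - ?S d k)"
      by (simp only:) simp
    also have "of_nat (p ^ s) dvd \<dots>"
      using cd that by (intro dvd_add) blast+
    finally show ?thesis .
  qed
  ultimately show ?thesis
    unfolding kspan_def by (intro exI[of _ "\<lambda>r l. c r l + d r l"]) blast
qed

lemma kspan_sum:
  "(\<And>i. i \<in> A \<Longrightarrow> kspan p n g s t Iv (w i)) \<Longrightarrow> kspan p n g s t Iv (\<lambda>k. \<Sum>i\<in>A. w i k)"
  by (induction A rule: infinite_finite_induct) (simp_all add: kspan_0 kspan_add)

text \<open>A quasi-constant modulo \<open>p ^ t\<close> is one modulo every lower power too, so it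
  can be absorbed into all the coefficients.\<close>

lemma kspan_scale:
  assumes "kspan p n g s t Iv w" "quasi_const n p t f"
  shows "kspan p n g s t Iv (\<lambda>k. f * w k)"
proof -
  let ?S = "\<lambda>c k. \<Sum>r\<in>{1..t}. \<Sum>l\<in>{1..g}. c r l * of_nat (p ^ (s - r)) * Iv r l k"
  obtain c where c: "\<forall>r\<in>{1..t}. \<forall>l\<in>{1..g}. quasi_const n p r (c r l)"
    and w: "\<forall>k\<in>{1..n}. of_nat (p ^ s) dvd w k - ?S c k"
    using assms unfolding kspan_def by blast
  have "\<forall>r\<in>{1..t}. \<forall>l\<in>{1..g}. quasi_const n p r (f * c r l)"
    using c quasi_const_mono[OF assms(2)] by (simp add: quasi_const_mult)
  moreover have "of_nat (p ^ s) dvd f * w k - ?S (\<lambda>r l. f * c r l) k" if "k \<in> {1..n}" for k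
  proof -
    have "f * w k - ?S (\<lambda>r l. f * c r l) k = f * (w k - ?S c k)"
      by (simp add: right_diff_distrib sum_distrib_left mult.assoc)
    also have "of_nat (p ^ s) dvd \<dots>"
      using w that by (intro dvd_mult) blast
    finally show ?thesis .
  qed
  ultimately show ?thesis
    unfolding kspan_def by (intro exI[of _ "\<lambda>r l. f * c r l"]) blast
qed

lemma kspan_mono:
  assumes "kspan p n g s t Iv w" "t \<le> t'"
  shows "kspan p n g s t' Iv w"
proof -
  obtain c where c: "\<forall>r\<in>{1..t}. \<forall>l\<in>{1..g}. quasi_const n p r (c r l)"
    and w: "\<forall>k\<in>{1..n}. of_nat (p ^ s) dvd
      w k - (\<Sum>r\<in>{1..t}. \<Sum>l\<in>{1..g}. c r l * of_nat (p ^ (s - r)) * Iv r l k)"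
    using assms unfolding kspan_def by blast
  let ?c = "\<lambda>r l. if r \<le> t then c r l else 0"
  have "(\<Sum>r\<in>{1..t}. \<Sum>l\<in>{1..g}. c r l * of_nat (p ^ (s - r)) * Iv r l k) =
      (\<Sum>r\<in>{1..t'}. \<Sum>l\<in>{1..g}. ?c r l * of_nat (p ^ (s - r)) * Iv r l k)" for k
    using assms(2) by (intro sum.mono_neutral_cong_left) auto
  moreover have "\<forall>r\<in>{1..t'}. \<forall>l\<in>{1..g}. quasi_const n p r (?c r l)"
    using c by (simp add: quasi_const_0)
  ultimately show ?thesis
    using w unfolding kspan_def by (intro exI[of _ ?c]) simp
qed

lemma kspan_generator:
  assumes "r \<in> {1..t}" "l \<in> {1..g}"
  shows "kspan p n g s t Iv (\<lambda>k. of_nat (p ^ (s - r)) * Iv r l k)"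
proof -
  let ?c = "\<lambda>r' l'. if l' = l then if r' = r then 1 else 0 else 0"
  have "(\<Sum>r'\<in>{1..t}. \<Sum>l'\<in>{1..g}. ?c r' l' * of_nat (p ^ (s - r')) * Iv r' l' k) =
      (\<Sum>r'\<in>{1..t}. \<Sum>l'\<in>{1..g}. if l' = l then
         (if r' = r then of_nat (p ^ (s - r')) * Iv r' l' k else 0) else 0)" for k
    by (intro sum.cong refl) auto
  also have "\<dots> k = of_nat (p ^ (s - r)) * Iv r l k" for k
    using assms by simp
  finally show ?thesis
    unfolding kspan_def by (intro exI[of _ ?c]) (simp add: quasi_const_0 quasi_const_1)
qed

lemma kspan_zero_level:
  "kspan p n g s t Iv (\<lambda>k. of_nat (p ^ s) * w k)"
  by (rule kspan_cong_dvd[OF kspan_0]) simp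

text \<open>A generator of level \<open>r\<close> must lie in the span of level \<open>r\<close>,
  not merely \<open>t\<close>: its coefficient is a quasi-constant only modulo \<open>p ^ r\<close>
  and may scale only spans up to that level.\<close>

lemma kspan_subset:
  assumes "kspan p n g s t Iv w"
    and gen: "\<And>r l. r \<in> {1..t} \<Longrightarrow> l \<in> {1..g} \<Longrightarrow>
      kspan p n g s r Iv' (\<lambda>k. of_nat (p ^ (s - r)) * Iv r l k)"
  shows "kspan p n g s t Iv' w"
proof -
  obtain c where c: "\<forall>r\<in>{1..t}. \<forall>l\<in>{1..g}. quasi_const n p r (c r l)"
    and w: "\<forall>k\<in>{1..n}. of_nat (p ^ s) dvd
      w k - (\<Sum>r\<in>{1..t}. \<Sum>l\<in>{1..g}. c r l * of_nat (p ^ (s - r)) * Iv r l k)"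
    using assms unfolding kspan_def by blast
  have "kspan p n g s t Iv' (\<lambda>k. c r l * of_nat (p ^ (s - r)) * Iv r l k)"
    if "r \<in> {1..t}" "l \<in> {1..g}" for r l
  proof -
    have "quasi_const n p r (c r l)" using c that by blast
    then have "kspan p n g s r Iv' (\<lambda>k. c r l * (of_nat (p ^ (s - r)) * Iv r l k))"
      by (rule kspan_scale[OF gen[OF that]])
    moreover have "r \<le> t" using that by simp
    ultimately show ?thesis by (simp only: kspan_mono mult.assoc)
  qed
  then have "kspan p n g s t Iv' (\<lambda>k. \<Sum>r\<in>{1..t}. \<Sum>l\<in>{1..g}. c r l * of_nat (p ^ (s - r)) * Iv r l k)"
    by (intro kspan_sum)
  then show ?thesis by (rule kspan_cong_dvd) (use w in blast)
qed

subsection \<open>Changing the shift\<close>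

lemma degree_lin_power_le: "degree (lin u i ^ k) \<le> k"
  using degree_power_le[of "lin u i" k] by (simp add: lin_def)

lemma degree_shcomp_less:
  assumes "M \<ge> 1" "a \<in> {1..n}"
  shows "degree (shcomp u n M a) < n * M"
proof -
  have n: "n \<ge> 1" using assms(2) by auto
  have "degree (\<Prod>i\<in>{1..n} - {a}. lin u i ^ M) \<le> (\<Sum>i\<in>{1..n} - {a}. degree (lin u i ^ M))"
    using degree_prod_sum_le[of "{1..n} - {a}" "\<lambda>i. lin u i ^ M"] by (simp add: comp_def)
  also have "\<dots> \<le> (\<Sum>i\<in>{1..n} - {a}. M)"
    by (intro sum_mono degree_lin_power_le)
  also have "\<dots> = (n - 1) * M"
    using assms(2) by simp
  finally have "degree (shcomp u n M a) \<le> (M - 1) + (n - 1) * M"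
    unfolding shcomp_def using degree_lin_power_le[of u a "M - 1"]
    by (meson add_mono degree_mult_le order_trans)
  also have "\<dots> < M + (n - 1) * M"
    using assms(1) by simp
  also have "\<dots> = n * M"
    using n by (cases n) simp_all
  finally show ?thesis .
qed

lemma pcompose_power: "pcompose (P ^ k) Q = pcompose P Q ^ k"
  by (induction k) (simp_all add: pcompose_1 pcompose_mult)

lemma pcompose_shcomp: "pcompose (shcomp u n M a) [:w, 1:] = shcomp (u + w) n M a"
proof -
  have "pcompose (lin u i) [:w, 1:] = lin (u + w) i" for i
    by (simp add: lin_def pcompose_pCons algebra_simps)
  then show ?thesis
    by (simp add: shcomp_def pcompose_mult pcompose_prod pcompose_power)
qed

text \<open>Binomial expansion of each power of x + w; for \<open>m < N\<close> the binomial
  coefficient is 0, so the truncated exponent is harmless.\<close>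

lemma coeff_pcompose_shift:
  "coeff (pcompose P [:w, 1:]) N = (\<Sum>m\<le>degree P. of_nat (m choose N) * w ^ (m - N) * coeff P m)"
  for P :: "'a::comm_ring_1 poly"
proof -
  have lin: "coeff ([:w, 1:] ^ m) N = of_nat (m choose N) * w ^ (m - N)" for m
  proof (cases "N \<le> m")
    case True
    then show ?thesis by (simp add: coeff_linear_poly_power)
  next
    case False
    have "degree ([:w, 1:] ^ m) \<le> m"
      using degree_power_le[of "[:w, 1:]" m] by simp
    then show ?thesis using False by (simp add: coeff_eq_0 binomial_eq_0)
  qed
  have "pcompose P [:w, 1:] = (\<Sum>m\<le>degree P. smult (coeff P m) ([:w, 1:] ^ m))"
    unfolding pcompose_altdef poly_altdef
    by (simp add: coeff_map_poly degree_map_poly)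
  then show ?thesis
    by (simp add: coeff_sum lin algebra_simps)
qed

lemma shcomp_add_mult:
  assumes "M \<ge> 1" "a \<in> {1..n}"
  shows "shcomp u n (M + q * e) a = shcomp u n M a * (\<Prod>i\<in>{1..n}. lin u i ^ e) ^ q"
proof -
  have "(\<Prod>i\<in>{1..n}. lin u i ^ e) ^ q = lin u a ^ (q * e) * (\<Prod>i\<in>{1..n} - {a}. lin u i ^ (q * e))"
    using assms(2) unfolding prod_power_distrib power_mult[symmetric]
    by (subst prod.remove[of _ a]) (simp_all add: mult.commute)
  moreover have "M + q * e - 1 = (M - 1) + q * e"
    using assms(1) by simp
  ultimately show ?thesis
    by (simp only: shcomp_def power_add prod.distrib mult_ac)
qed

lemma in_Zzx_lin:
  assumes "in_Zz n u" "i \<in> {1..n}"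
  shows "in_Zzx n (lin u i)"
  using assms
  by (simp add: in_Zzx_def lin_def coeff_pCons in_Zz_diff in_Zz_Var in_Zz_0 in_Zz_1 split: nat.split)

section \<open>The vectors of the theorem as shifted vectors\<close>

definition Ish :: "mpoly \<Rightarrow> nat \<Rightarrow> nat \<Rightarrow> nat \<Rightarrow> nat \<Rightarrow> nat \<Rightarrow> mpoly" where
  "Ish u p n r l k = coeff (shcomp u n (Mr p r) k) (l * p ^ r - 1)"

lemma Ivec_eq_Ish: "Ivec p n = Ish 0 p n"
  by (intro ext) (simp add: Ivec_def Ish_def PhiComp_def shcomp_def lin_def)

lemma IvecT_eq_Ish: "IvecT p n = Ish (Var n) p n"
proof -
  have "PhiComp p n r k = shcomp 0 n (Mr p r) k" for r k
    by (simp add: PhiComp_def shcomp_def lin_def)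
  then show ?thesis
    by (intro ext) (simp add: IvecT_def Ish_def PhiCompT_def pcompose_shcomp)
qed

lemma two_Mr:
  assumes "odd p"
  shows "2 * Mr p r + 1 = p ^ r"
proof -
  have "odd (p ^ r)" using assms by simp
  then show ?thesis by (auto simp: Mr_def elim: oddE)
qed

lemma Mr_ge_1:
  assumes "prime p" "odd p" "r \<ge> 1"
  shows "Mr p r \<ge> 1"
proof -
  have "p > 1" using assms(1) prime_gt_1_nat by blast
  then have "p ^ r > 1" using assms(3) by (intro one_less_power) auto
  then show ?thesis using two_Mr[OF assms(2), of r] by simp
qed

text \<open>This identity is why the master polynomials of levels \<open>s\<close> and
  \<open>j\<close> differ by a \<open>p ^ j\<close>-th power.\<close>

lemma Mr_split:
  assumes "odd p" "j \<le> s"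
  shows "Mr p s = Mr p j + p ^ j * Mr p (s - j)"
proof -
  have "p ^ s = p ^ j * p ^ (s - j)"
    using assms(2) by (simp flip: power_add)
  then have "2 * Mr p s + 1 = p ^ j * (2 * Mr p (s - j) + 1)"
    by (simp only: two_Mr[OF assms(1)])
  also have "\<dots> = 2 * (p ^ j * Mr p (s - j)) + p ^ j"
    by (simp add: algebra_simps)
  also have "\<dots> = 2 * (p ^ j * Mr p (s - j)) + (2 * Mr p j + 1)"
    by (simp only: two_Mr[OF assms(1)])
  finally show ?thesis by simp
qed

section \<open>Reduction of levels and change of shift, for a fixed modulus exponent
  \<open>S\<close>\<close>

context
  fixes p g n S :: nat and u :: mpoly
  assumes p: "prime p" "odd p" and n: "n = 2 * g + 1" and u: "in_Zz n u"
begin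

text \<open>For \<open>l > g\<close> the exponent \<open>l * p ^ r - 1\<close> exceeds the degree,
  which is below n M_r. Hence the bound \<open>l \<le> g\<close> in the modules loses no
  generators.\<close>

lemma Ish_eq_0:
  assumes "r \<ge> 1" "l > g" "k \<in> {1..n}"
  shows "Ish u p n r l k = 0"
proof -
  have "2 * (n * Mr p r) < 2 * (l * p ^ r)"
  proof -
    have "2 * (n * Mr p r) < n * (2 * Mr p r + 1)" using n by (simp add: algebra_simps)
    also have "\<dots> = n * p ^ r" by (simp only: two_Mr[OF p(2)])
    also have "\<dots> \<le> (2 * l) * p ^ r" using n assms(2) by (intro mult_right_mono) auto
    finally show ?thesis by simp
  qed
  then have "degree (shcomp u n (Mr p r) k) < l * p ^ r - 1"
    using degree_shcomp_less[OF Mr_ge_1[OF p assms(1)] assms(3), of u] by simp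
  then show ?thesis unfolding Ish_def by (rule coeff_eq_0)
qed

abbreviation in_span :: "nat \<Rightarrow> (nat \<Rightarrow> mpoly) \<Rightarrow> bool" where
  "in_span t \<equiv> kspan p n g S t (Ish u p n)"

lemma in_span_Ish:
  assumes "r \<ge> 1" "l \<ge> 1"
  shows "in_span r (\<lambda>k. of_nat (p ^ (S - r)) * Ish u p n r l k)"
proof (cases "l \<le> g")
  case True
  then show ?thesis using assms by (intro kspan_generator) auto
next
  case False
  then show ?thesis
    by (intro kspan_cong_dvd[OF kspan_0]) (simp add: Ish_eq_0[OF assms(1)])
qed

text \<open>\<open>\<Phi>\<close> at level \<open>s\<close> is \<open>\<Phi>\<close> at level \<open>j\<close> times a \<open>p\<^sup>j\<close>-th power,
  whose coefficients are admissible of level \<open>j\<close>.\<close>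

lemma in_span_higher:
  assumes "j \<le> s" "j \<le> S" "m \<ge> 1"
    and adm: "\<And>k f. k \<ge> 1 \<Longrightarrow> admissible n p j k f \<Longrightarrow>
      in_span j (\<lambda>a. f * (of_nat (p ^ (S - j)) * coeff (shcomp u n (Mr p j) a) (k - 1)))"
  shows "in_span j (\<lambda>a. of_nat (p ^ (S - j)) * coeff (shcomp u n (Mr p s) a) (m * p ^ j - 1))"
proof (cases "j = 0")
  case True
  then show ?thesis by (simp add: kspan_zero_level del: of_nat_power)
next
  case False
  then have M: "Mr p j \<ge> 1" by (intro Mr_ge_1 p) simp
  have "p ^ j > 0" using p(1) prime_gt_0_nat by simp
  then have "m * p ^ j \<ge> 1" using assms(3) by (simp add: Suc_le_eq)
  define A where "A = (\<Prod>i\<in>{1..n}. lin u i ^ Mr p (s - j)) ^ (p ^ j)"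
  have A: "admissible n p j k (coeff A k)" for k
    unfolding A_def by (intro admissible_coeff_power in_Zzx_prod in_Zzx_power in_Zzx_lin u)
  \<comment> \<open>In the convolution, index \<open>i\<close> of the power \<open>A\<close> meets
    index \<open>k - 1\<close> of the level-\<open>j\<close> factor with
    \<open>k = m * p ^ j - i\<close>; admissibility at \<open>i\<close> passes to this
    complement.\<close>
  have "in_span j (\<lambda>a. coeff A i *
      (of_nat (p ^ (S - j)) * coeff (shcomp u n (Mr p j) a) (m * p ^ j - i - 1)))"
    if "i \<in> {..m * p ^ j - 1}" for i
  proof -
    have "m * p ^ j - i \<ge> 1" "i \<le> m * p ^ j"
      using that \<open>m * p ^ j \<ge> 1\<close> by (simp_all only: atMost_iff)
    then show ?thesis by (intro adm admissible_complement A)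
  qed
  then have "in_span j (\<lambda>a. \<Sum>i\<le>m * p ^ j - 1. coeff A i *
      (of_nat (p ^ (S - j)) * coeff (shcomp u n (Mr p j) a) (m * p ^ j - i - 1)))"
    by (rule kspan_sum)
  then show ?thesis
  proof (rule kspan_cong_dvd)
    fix a assume a: "a \<in> {1..n}"
    have "shcomp u n (Mr p s) a = A * shcomp u n (Mr p j) a"
      unfolding A_def Mr_split[OF p(2) assms(1)] shcomp_add_mult[OF M a] by (simp only: mult.commute)
    then have "of_nat (p ^ (S - j)) * coeff (shcomp u n (Mr p s) a) (m * p ^ j - 1) =
      (\<Sum>i\<le>m * p ^ j - 1. coeff A i *
        (of_nat (p ^ (S - j)) * coeff (shcomp u n (Mr p j) a) (m * p ^ j - i - 1)))"
      by (simp add: coeff_mult sum_distrib_left mult_ac diff_commute)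
    then show "of_nat (p ^ S) dvd
      of_nat (p ^ (S - j)) * coeff (shcomp u n (Mr p s) a) (m * p ^ j - 1) -
      (\<Sum>i\<le>m * p ^ j - 1. coeff A i *
        (of_nat (p ^ (S - j)) * coeff (shcomp u n (Mr p j) a) (m * p ^ j - i - 1)))"
      by simp
  qed
qed

text \<open>Strong induction on the level. Writing k = m p^i and f = p^(j-i) f', the power taken out
  of \<open>f\<close> turns p^(S-j) into p^(S-i), so the term lives at level
  \<open>i\<close>.\<close>

lemma in_span_admissible:
  assumes "j \<le> S" "k \<ge> 1" "admissible n p j k f"
  shows "in_span j (\<lambda>a. f * (of_nat (p ^ (S - j)) * coeff (shcomp u n (Mr p j) a) (k - 1)))"
  using assms
proof (induction j arbitrary: k f rule: less_induct)
  case (less j)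
  obtain i f' where i: "i \<le> j" "p ^ i dvd k" and f: "f = of_nat (p ^ (j - i)) * f'"
    and f': "quasi_const n p i f'"
    using admissible_decomp[OF p(1) less.prems(3)] by blast
  obtain m where k: "k = m * p ^ i" using i(2) by (metis dvdE mult.commute)
  have m: "m \<ge> 1" using less.prems(2) k by (cases m) auto
  have "in_span i (\<lambda>a. of_nat (p ^ (S - i)) * coeff (shcomp u n (Mr p j) a) (m * p ^ i - 1))"
  \<comment> \<open>If the level does not drop, the vector is itself a generator, zero for m > g, or
    a multiple of p^S at level 0.\<close>
  proof (cases "i = j")
    case True
    show ?thesis
    proof (cases "j = 0")
      case True
      with \<open>i = j\<close> show ?thesis by (simp add: kspan_zero_level del: of_nat_power)
    next
      case False
      then show ?thesis
        using in_span_Ish[of j m] m unfolding Ish_def \<open>i = j\<close> by simp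
    qed
  next
    case False
    then show ?thesis
      \<comment> \<open>If it drops, the induction hypothesis at level \<open>i\<close> is exactly
        the premise on admissible coefficients.\<close>
      using i(1) less.prems(1) by (intro in_span_higher less.IH m) auto
  qed
  then have "in_span j (\<lambda>a. f' *
      (of_nat (p ^ (S - i)) * coeff (shcomp u n (Mr p j) a) (m * p ^ i - 1)))"
    using kspan_mono[OF kspan_scale[OF _ f'] i(1)] by blast
  moreover have "p ^ (S - i) = p ^ (j - i) * p ^ (S - j)"
    using i(1) less.prems(1) by (simp flip: power_add)
  ultimately show ?case
    unfolding f k by (simp only: of_nat_mult mult_ac)
qed

lemma in_span_shift:
  assumes "in_Zz n w" "r \<ge> 1" "r \<le> S" "l \<ge> 1"
  shows "in_span r (\<lambda>a. of_nat (p ^ (S - r)) * Ish (u + w) p n r l a)"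
proof -
  let ?N = "l * p ^ r - 1"
  let ?F = "shcomp u n (Mr p r)"
  have N: "?N + 1 = l * p ^ r" using assms(4) p(1) prime_gt_0_nat by simp
  have "in_span r (\<lambda>a. of_nat (m choose ?N) * w ^ (m - ?N) *
      (of_nat (p ^ (S - r)) * coeff (?F a) m))" for m
    using in_span_admissible[OF assms(3) _ admissible_binomial[OF assms(1) N], of m] by simp
  \<comment> \<open>The range must not depend on the component \<open>a\<close>, so the degree is
    replaced by a common bound.\<close>
  then have "in_span r (\<lambda>a. \<Sum>m\<le>n * Mr p r. of_nat (m choose ?N) * w ^ (m - ?N) *
      (of_nat (p ^ (S - r)) * coeff (?F a) m))"
    by (rule kspan_sum)
  then show ?thesis
  proof (rule kspan_cong_dvd)
    fix a assume a: "a \<in> {1..n}"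
    have "(\<Sum>m\<le>degree (?F a). of_nat (m choose ?N) * w ^ (m - ?N) * coeff (?F a) m) =
        (\<Sum>m\<le>n * Mr p r. of_nat (m choose ?N) * w ^ (m - ?N) * coeff (?F a) m)"
      using degree_shcomp_less[OF Mr_ge_1[OF p assms(2)] a, of u]
      by (intro sum.mono_neutral_left) (auto simp: coeff_eq_0)
    then have "of_nat (p ^ (S - r)) * Ish (u + w) p n r l a =
      (\<Sum>m\<le>n * Mr p r. of_nat (m choose ?N) * w ^ (m - ?N) *
        (of_nat (p ^ (S - r)) * coeff (?F a) m))"
      unfolding Ish_def pcompose_shcomp[symmetric] coeff_pcompose_shift
      by (simp add: sum_distrib_left mult_ac)
    then show "of_nat (p ^ S) dvd of_nat (p ^ (S - r)) * Ish (u + w) p n r l a -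
      (\<Sum>m\<le>n * Mr p r. of_nat (m choose ?N) * w ^ (m - ?N) *
        (of_nat (p ^ (S - r)) * coeff (?F a) m))"
      by simp
  qed
qed

lemma Mspace_shift_subset:
  assumes "in_Zz n w" "t \<le> S"
  shows "Mspace p n g S t (Ish (u + w) p n) \<subseteq> Mspace p n g S t (Ish u p n)"
proof -
  have "in_span t v" if "kspan p n g S t (Ish (u + w) p n) v" for v
    using that
  proof (rule kspan_subset)
    fix r l assume "r \<in> {1..t}" "l \<in> {1..g}"
    then show "in_span r (\<lambda>k. of_nat (p ^ (S - r)) * Ish (u + w) p n r l k)"
      using assms by (intro in_span_shift) auto
  qed
  then show ?thesis unfolding Mspace_eq_kspan by blast
qed

end

theorem theorem9p1:
  fixes p g n s l :: nat
  assumes "prime p" and "odd p" and "g \<ge> 1" and "n = 2 * g + 1" and "p > n"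
    and "s \<ge> 1" and "l \<ge> 1"
  shows "KZ_sol_mod (int p ^ s) n (IvecT p n s l)
    \<and> (\<forall>t\<in>{1..s}. Mt_space p n g s t = M_space p n g s t)"
proof
  have "p ^ s > 0" using assms(5) by simp
  then have "l * p ^ s \<ge> 1" using assms(7) by (simp add: Suc_le_eq)
  then have N: "l * p ^ s - 1 + 1 = l * p ^ s" by (rule le_add_diff_inverse2)
  have "KZ_sol_mod (int (p ^ s)) n (\<lambda>a. coeff (shcomp (Var n) n (Mr p s) a) (l * p ^ s - 1))"
    by (rule KZ_sol_mod_coeff_shcomp[OF Mr_ge_1[OF assms(1,2,6)] two_Mr[OF assms(2), symmetric] N])
  then show "KZ_sol_mod (int p ^ s) n (IvecT p n s l)"
    by (simp add: IvecT_eq_Ish Ish_def[abs_def])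
next
  have z: "in_Zz n (Var n)" using assms(4) by (intro in_Zz_Var) simp
  show "\<forall>t\<in>{1..s}. Mt_space p n g s t = M_space p n g s t"
  proof
    fix t assume "t \<in> {1..s}"
    then have t: "t \<le> s" by simp
    have "Mspace p n g s t (Ish (0 + Var n) p n) \<subseteq> Mspace p n g s t (Ish 0 p n)"
      by (rule Mspace_shift_subset[OF assms(1,2,4) in_Zz_0 z t])
    \<comment> \<open>Shifting back by -z_n gives the opposite inclusion.\<close>
    moreover have "Mspace p n g s t (Ish (Var n + - Var n) p n) \<subseteq> Mspace p n g s t (Ish (Var n) p n)"
      by (rule Mspace_shift_subset[OF assms(1,2,4) z in_Zz_minus[OF z] t])
    ultimately show "Mt_space p n g s t = M_space p n g s t"
      unfolding Mt_space_def M_space_def Ivec_eq_Ish IvecT_eq_Ish by simp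
  qed
qed

end
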